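(* Let $\Omega\subset\mathbb{R}^2$ be an open, bounded, convex domain with boundary $\partial\Omega$, and let $\varphi:\partial B_2\to\partial\Omega$ be a continuous parametrization of the boundary, i.e. a continuous one-to-one map of $\partial B_2$ onto $\partial\Omega$. Then $(\mathcal{E}\varphi)(B_2)\subset\overline{\Omega}$.
   Context: $B_2$ is the open unit disk in $\mathbb{R}^2$ and $\partial B_2$ the unit circle. A function $\varphi$ on $\partial B_2$ is identified with the $2\pi$-periodic function on $\mathbb{R}$ given by $\theta\mapsto\varphi(\cos\theta,\sin\theta)$, again denoted $\varphi$. Let $\arccos:[-1,1]\to[0,\pi]$ be the usual inverse cosine and $\widetilde{\arccos}(x)=2\pi-\arccos(x)\in[\pi,2\pi]$. For $0\le r<1$ and $0\le\theta\le\pi$ put $$\psi_+(r,\theta)=\arccos\left(r\sin^2\theta+\cos\theta\sqrt{1-r^2\sin^2\theta}\right),\quad \psi_-(r,\theta)=\widetilde{\arccos}\left(r\sin^2\theta-\cos\theta\sqrt{1-r^2\sin^2\theta}\right).$$ For $0\le r<1$ and $0\le\theta\le2\pi$ define $\psi_*(r,\theta)=\psi_+(r,\theta)$ if $0\le\theta\le\pi$, and $\psi_*(r,\theta)=\psi_-(r,\theta-\pi)$ if $\pi<\theta\le 2\pi$. Also define $$k(r,\theta)=1+\frac{r\cos\theta}{\sqrt{1-r^2\sin^2\theta}},\qquad 0\le r<1,\ 0\le\theta\le2\pi.$$ The extension operator $\mathcal{E}$ is defined, for $P=r(\cos\alpha,\sin\alpha)\in B_2$ with $r\in[0,1)$,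 $\alpha\in[0,2\pi)$, by $$(\mathcal{E}\varphi)(P)=\frac{1}{2\pi}\int_0^{2\pi}k(r,\theta)\,\varphi(\psi_*(r,\theta)+\alpha)\,d\theta$$ (for $P=0$ the value does not depend on $\alpha$). *)

theory Defs
  imports "HOL-Analysis.Analysis"
begin

definition circle_pt :: "real \<Rightarrow> real ^ 2" where
  "circle_pt \<theta> = vector [cos \<theta>, sin \<theta>]"

definition arccos_tilde :: "real \<Rightarrow> real" where
  "arccos_tilde x = 2 * pi - arccos x"

definition psi_plus :: "real \<Rightarrow> real \<Rightarrow> real" where
  "psi_plus r \<theta> =
     arccos (r * (sin \<theta>)\<^sup>2 + cos \<theta> * sqrt (1 - r\<^sup>2 * (sin \<theta>)\<^sup>2))"

definition psi_minus :: "real \<Rightarrow> real \<Rightarrow> real" where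
  "psi_minus r \<theta> =
     arccos_tilde (r * (sin \<theta>)\<^sup>2 - cos \<theta> * sqrt (1 - r\<^sup>2 * (sin \<theta>)\<^sup>2))"

definition psi_star :: "real \<Rightarrow> real \<Rightarrow> real" where
  "psi_star r \<theta> = (if \<theta> \<le> pi then psi_plus r \<theta> else psi_minus r (\<theta> - pi))"

definition kern :: "real \<Rightarrow> real \<Rightarrow> real" where
  "kern r \<theta> = 1 + r * cos \<theta> / sqrt (1 - r\<^sup>2 * (sin \<theta>)\<^sup>2)"

text \<open>The polar angle in \<open>[0, 2\<pi>)\<close>; at the origin it is \<open>0\<close>, which is harmless:
  for \<open>r = 0\<close> the average defining \<open>extension\<close> is rotation invariant.\<close>

definition polar_angle :: "real ^ 2 \<Rightarrow> real" where
  "polar_angle P = Arg2pi (Complex (P $ 1) (P $ 2))"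

definition extension :: "(real ^ 2 \<Rightarrow> 'b::euclidean_space) \<Rightarrow> real ^ 2 \<Rightarrow> 'b" where
  "extension \<phi> P =
     (1 / (2 * pi)) *\<^sub>R
       integral {0..2 * pi}
         (\<lambda>\<theta>. kern (norm P) \<theta> *\<^sub>R \<phi> (circle_pt (psi_star (norm P) \<theta> + polar_angle P)))"

lemma norm_polar: "0 \<le> r \<Longrightarrow> norm (r *\<^sub>R circle_pt \<alpha>) = r"
  by (simp add: circle_pt_def norm_eq_sqrt_inner inner_vec_def UNIV_2 flip: power2_eq_square)
     (simp add: power_mult_distrib flip: distrib_left)

lemma polar_angle_polar:
  assumes "0 < r" "0 \<le> \<alpha>" "\<alpha> < 2 * pi"
  shows "polar_angle (r *\<^sub>R circle_pt \<alpha>) = \<alpha>"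
  unfolding polar_angle_def
  by (rule Arg2pi_unique[where r = r])
     (use assms in \<open>auto simp: circle_pt_def complex_eq_iff Re_exp Im_exp\<close>)

lemma extension_polar:
  assumes "0 < r" "0 \<le> \<alpha>" "\<alpha> < 2 * pi"
  shows "extension \<phi> (r *\<^sub>R circle_pt \<alpha>) =
    (1 / (2 * pi)) *\<^sub>R
      integral {0..2 * pi} (\<lambda>\<theta>. kern r \<theta> *\<^sub>R \<phi> (circle_pt (psi_star r \<theta> + \<alpha>)))"
  using assms by (simp only: extension_def norm_polar polar_angle_polar less_imp_le)

lemma psi_star_0:
  assumes "0 \<le> \<theta>" "\<theta> \<le> 2 * pi"
  shows "psi_star 0 \<theta> = \<theta>"
proof (cases "\<theta> \<le> pi")
  case True
  then show ?thesis using assms by (simp add: psi_star_def psi_plus_def arccos_cos)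
next
  case False
  have "arccos (cos \<theta>) = arccos (cos (2 * pi - \<theta>))" by simp
  also have "\<dots> = 2 * pi - \<theta>" using False assms by (intro arccos_cos) auto
  finally show ?thesis
    using False by (simp add: psi_star_def psi_minus_def arccos_tilde_def)
qed

end

theory Submission
  imports Defs
begin

text \<open>The value of the extension at a point of the disk is a weighted mean of boundary values of
  \<open>\<phi>\<close>. The weight \<open>k(r, \<cdot>) / (2\<pi>)\<close> is nonnegative and has total mass \<open>1\<close>, and the values of
  \<open>\<phi>\<close> lie in the closed convex set \<open>closure \<Omega>\<close>, so the mean lies there as well
  (\<open>weighted_mean_in_closed_convex\<close>).

  What makes the weight and the angle easy to handle is the substitution \<open>\<beta> = arcsin (r sin \<theta>)\<close>.
  Since \<open>cos \<beta> = sqrt (1 - r\<^sup>2 sin\<^sup>2 \<theta>)\<close>, the argument of the inverse cosine in \<open>\<psi>\<^sub>+\<close> is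
  \<open>cos (\<theta> - \<beta>)\<close>, and the two branches of \<open>\<psi>\<^sub>*\<close> merge into the single formula
  \<open>\<psi>\<^sub>* = \<theta> - \<beta>\<close> (\<open>psi_star_eq\<close>), which shows that the integrand is continuous. The kernel is the
  derivative of \<open>\<theta> + \<beta>\<close>, and \<open>\<beta>\<close> vanishes at both \<open>0\<close> and \<open>2\<pi>\<close>; hence its integral is
  \<open>2\<pi>\<close> (\<open>kern_has_integral\<close>).\<close>

text \<open>A half-space that contains \<open>C\<close> contains every weighted mean of points of \<open>C\<close>, because the
  linear functional defining it commutes with the integral; and a closed convex set is the
  intersection of such half-spaces.\<close>

lemma weighted_mean_in_closed_convex:
  fixes f :: "'a::euclidean_space \<Rightarrow> 'b::euclidean_space" and w :: "'a \<Rightarrow> real"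
  assumes C: "closed C" "convex C"
    and f: "\<And>x. x \<in> S \<Longrightarrow> f x \<in> C"
    and w: "\<And>x. x \<in> S \<Longrightarrow> 0 \<le> w x" "(w has_integral m) S" "0 < m"
    and int: "(\<lambda>x. w x *\<^sub>R f x) integrable_on S"
  shows "(1 / m) *\<^sub>R integral S (\<lambda>x. w x *\<^sub>R f x) \<in> C"
proof (rule ccontr)
  define I where "I = integral S (\<lambda>x. w x *\<^sub>R f x)"
  assume "(1 / m) *\<^sub>R integral S (\<lambda>x. w x *\<^sub>R f x) \<notin> C"
  then obtain a b where ab: "a \<bullet> ((1 / m) *\<^sub>R I) < b" "\<And>x. x \<in> C \<Longrightarrow> b < a \<bullet> x"
    using separating_hyperplane_closed_point[OF C(2,1)] unfolding I_def by metis
  have "((\<lambda>x. a \<bullet> (w x *\<^sub>R f x)) has_integral a \<bullet> I) S"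
    using has_integral_linear[OF integrable_integral[OF int] bounded_linear_inner_right]
    by (simp add: I_def o_def)
  then have "m * b \<le> a \<bullet> I"
    by (rule has_integral_le[OF has_integral_mult_left[OF w(2)]])
      (simp add: mult_left_mono less_imp_le ab(2) f w(1))
  with ab(1) w(3) show False
    by (simp add: field_simps)
qed

lemma abs_r_sin_less_1:
  fixes r \<theta> :: real
  assumes "\<bar>r\<bar> < 1"
  shows "\<bar>r * sin \<theta>\<bar> < 1"
proof -
  have "\<bar>r * sin \<theta>\<bar> \<le> \<bar>r\<bar> * 1"
    unfolding abs_mult by (intro mult_left_mono) auto
  with assms show ?thesis by simp
qed

lemma one_minus_r_sin_sq_pos:
  fixes r \<theta> :: real
  assumes "\<bar>r\<bar> < 1"
  shows "0 < 1 - r\<^sup>2 * (sin \<theta>)\<^sup>2"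
  using abs_r_sin_less_1[OF assms, of \<theta>]
  by (simp add: abs_square_less_1 flip: power_mult_distrib)

text \<open>To remove the inverse cosine from \<open>\<psi>\<^sub>+\<close> one needs \<open>0 \<le> \<theta> - \<beta> \<le> \<pi>\<close>. This holds
  because \<open>\<beta>\<close> lies between \<open>0\<close> and \<open>arcsin (sin \<theta>)\<close>, which is the smaller of \<open>\<theta>\<close> and
  \<open>\<pi> - \<theta>\<close>. The bound by \<open>\<pi> - \<theta>\<close> does the same for \<open>\<theta> + \<beta>\<close> in \<open>\<psi>\<^sub>-\<close>.\<close>

lemma arcsin_r_sin_bounds:
  assumes r: "0 \<le> r" "r < 1" and \<theta>: "0 \<le> \<theta>" "\<theta> \<le> pi"
  shows "0 \<le> arcsin (r * sin \<theta>)" "arcsin (r * sin \<theta>) \<le> \<theta>" "arcsin (r * sin \<theta>) \<le> pi - \<theta>"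
proof -
  have s: "0 \<le> sin \<theta>" using \<theta> by (rule sin_ge_zero)
  have rs: "0 \<le> r * sin \<theta>" "r * sin \<theta> \<le> sin \<theta>"
    using r s by (auto intro: mult_left_le_one_le)
  show "0 \<le> arcsin (r * sin \<theta>)"
    using arcsin_le_arcsin[of 0 "r * sin \<theta>"] rs sin_le_one[of \<theta>] by simp
  have le: "arcsin (r * sin \<theta>) \<le> arcsin (sin \<theta>)"
    by (intro arcsin_le_arcsin) (use rs in auto)
  have "arcsin (sin \<theta>) \<le> \<theta> \<and> arcsin (sin \<theta>) \<le> pi - \<theta>"
  proof (cases "\<theta> \<le> pi / 2")
    case True
    then have "arcsin (sin \<theta>) = \<theta>"
      using \<theta> by (intro arcsin_sin) auto
    with True show ?thesis by simp
  next
    case False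
    then have "arcsin (sin (pi - \<theta>)) = pi - \<theta>"
      using \<theta> by (intro arcsin_sin) auto
    with False show ?thesis by simp
  qed
  with le show "arcsin (r * sin \<theta>) \<le> \<theta>" "arcsin (r * sin \<theta>) \<le> pi - \<theta>"
    by auto
qed

lemma psi_plus_eq:
  assumes r: "0 \<le> r" "r < 1" and \<theta>: "0 \<le> \<theta>" "\<theta> \<le> pi"
  shows "psi_plus r \<theta> = \<theta> - arcsin (r * sin \<theta>)"
proof -
  let ?\<beta> = "arcsin (r * sin \<theta>)"
  have rs: "- 1 \<le> r * sin \<theta>" "r * sin \<theta> \<le> 1"
    using abs_r_sin_less_1[of r \<theta>] r by auto
  have "cos (\<theta> - ?\<beta>) = r * (sin \<theta>)\<^sup>2 + cos \<theta> * sqrt (1 - r\<^sup>2 * (sin \<theta>)\<^sup>2)"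
    using rs by (simp add: cos_diff cos_arcsin power_mult_distrib power2_eq_square)
  then have "psi_plus r \<theta> = arccos (cos (\<theta> - ?\<beta>))"
    by (simp add: psi_plus_def)
  also have "\<dots> = \<theta> - ?\<beta>"
    using arcsin_r_sin_bounds[OF assms] \<theta> by (intro arccos_cos) auto
  finally show ?thesis .
qed

lemma psi_minus_eq:
  assumes r: "0 \<le> r" "r < 1" and \<theta>: "0 \<le> \<theta>" "\<theta> \<le> pi"
  shows "psi_minus r \<theta> = pi + \<theta> + arcsin (r * sin \<theta>)"
proof -
  let ?\<beta> = "arcsin (r * sin \<theta>)"
  have rs: "- 1 \<le> r * sin \<theta>" "r * sin \<theta> \<le> 1"
    using abs_r_sin_less_1[of r \<theta>] r by auto
  have "cos (pi - (\<theta> + ?\<beta>)) = r * (sin \<theta>)\<^sup>2 - cos \<theta> * sqrt (1 - r\<^sup>2 * (sin \<theta>)\<^sup>2)"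
    using rs by (simp only: cos_pi_minus cos_add cos_arcsin sin_arcsin)
      (simp add: power_mult_distrib power2_eq_square)
  then have "psi_minus r \<theta> = 2 * pi - arccos (cos (pi - (\<theta> + ?\<beta>)))"
    by (simp add: psi_minus_def arccos_tilde_def)
  also have "arccos (cos (pi - (\<theta> + ?\<beta>))) = pi - (\<theta> + ?\<beta>)"
    using arcsin_r_sin_bounds[OF assms] \<theta> by (intro arccos_cos) auto
  finally show ?thesis by simp
qed

text \<open>Shifting \<open>\<theta>\<close> by \<open>\<pi>\<close> changes the sign of \<open>\<beta>\<close>, which is why the second branch continues the
  first one.\<close>

lemma psi_star_eq:
  assumes r: "0 \<le> r" "r < 1" and \<theta>: "0 \<le> \<theta>" "\<theta> \<le> 2 * pi"
  shows "psi_star r \<theta> = \<theta> - arcsin (r * sin \<theta>)"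
proof (cases "\<theta> \<le> pi")
  case True
  with assms show ?thesis by (simp add: psi_star_def psi_plus_eq)
next
  case False
  have "arcsin (r * sin (\<theta> - pi)) = - arcsin (r * sin \<theta>)"
    using abs_r_sin_less_1[of r \<theta>] r by (simp add: sin_diff arcsin_minus)
  with False assms show ?thesis by (simp add: psi_star_def psi_minus_eq)
qed

lemma continuous_on_psi_star:
  assumes "0 \<le> r" "r < 1"
  shows "continuous_on {0..2 * pi} (psi_star r)"
proof -
  have "- 1 \<le> r * sin \<theta> \<and> r * sin \<theta> \<le> 1" for \<theta>
    using abs_r_sin_less_1[of r \<theta>] assms by auto
  then have "continuous_on {0..2 * pi} (\<lambda>\<theta>. \<theta> - arcsin (r * sin \<theta>))"
    by (intro continuous_intros) auto
  then show ?thesis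
    using continuous_on_cong[of "{0..2 * pi}" "{0..2 * pi}" "psi_star r"] psi_star_eq assms
    by simp
qed

lemma continuous_on_kern:
  assumes "\<bar>r\<bar> < 1"
  shows "continuous_on S (kern r)"
  unfolding kern_def
  using one_minus_r_sin_sq_pos[OF assms] by (intro continuous_intros) (auto simp: less_le)

text \<open>The bound is \<open>r\<^sup>2 cos\<^sup>2 \<theta> \<le> 1 - r\<^sup>2 sin\<^sup>2 \<theta>\<close>, that is, \<open>r\<^sup>2 \<le> 1\<close>.\<close>

lemma kern_nonneg:
  assumes r: "\<bar>r\<bar> < 1"
  shows "0 \<le> kern r \<theta>"
proof -
  let ?q = "1 - r\<^sup>2 * (sin \<theta>)\<^sup>2"
  have "(r * cos \<theta>)\<^sup>2 + r\<^sup>2 * (sin \<theta>)\<^sup>2 = r\<^sup>2"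
    by (simp add: power_mult_distrib flip: distrib_left)
  moreover have "r\<^sup>2 < 1" using r by (simp add: abs_square_less_1)
  ultimately have "(r * cos \<theta>)\<^sup>2 \<le> ?q" by linarith
  then have "- (r * cos \<theta>) \<le> sqrt ?q" by (intro real_le_rsqrt) simp
  then show ?thesis
    using one_minus_r_sin_sq_pos[OF r, of \<theta>] by (simp add: kern_def field_simps)
qed

lemma kern_has_integral:
  assumes r: "\<bar>r\<bar> < 1"
  shows "(kern r has_integral 2 * pi) {0..2 * pi}"
proof -
  define F where "F = (\<lambda>\<theta>. \<theta> + arcsin (r * sin \<theta>))"
  have "(F has_real_derivative kern r \<theta>) (at \<theta>)" for \<theta>
    unfolding F_def kern_def
    using abs_r_sin_less_1[OF r, of \<theta>]
    by (auto intro!: derivative_eq_intros simp: power_mult_distrib field_simps)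
  then have "(kern r has_integral F (2 * pi) - F 0) {0..2 * pi}"
    by (intro fundamental_theorem_of_calculus)
      (auto simp: has_real_derivative_iff_has_vector_derivative
        intro: has_vector_derivative_at_within)
  then show ?thesis by (simp add: F_def)
qed

lemma circle_pt_in_sphere: "circle_pt \<theta> \<in> sphere 0 1"
  using norm_polar[of 1 \<theta>] by simp

lemma continuous_on_circle_pt: "continuous_on S circle_pt"
proof -
  have eq: "circle_pt = (\<lambda>\<theta>. \<chi> i. if i = 1 then cos \<theta> else sin \<theta>)"
    by (auto simp: circle_pt_def vec_eq_iff forall_2)
  have "continuous_on S (\<lambda>\<theta>. if i = 1 then cos \<theta> else sin \<theta>)" for i :: 2
    by (cases "i = 1") (auto intro: continuous_intros)
  then have "continuous_on S (\<lambda>\<theta>. \<chi> i :: 2. if i = 1 then cos \<theta> else sin \<theta>)"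
    by (rule continuous_on_vec_lambda)
  then show ?thesis
    unfolding eq .
qed

lemma extension_in_closed_convex:
  fixes \<phi> :: "real ^ 2 \<Rightarrow> 'b::euclidean_space"
  assumes C: "closed C" "convex C"
    and \<phi>: "continuous_on (sphere 0 1) \<phi>" "\<phi> ` sphere 0 1 \<subseteq> C"
    and P: "norm P < 1"
  shows "extension \<phi> P \<in> C"
  unfolding extension_def
proof (rule weighted_mean_in_closed_convex[OF C])
  let ?c = "\<lambda>\<theta>. circle_pt (psi_star (norm P) \<theta> + polar_angle P)"
  show "\<phi> (?c \<theta>) \<in> C" for \<theta>
    using \<phi>(2) circle_pt_in_sphere by blast
  show "0 \<le> kern (norm P) \<theta>" for \<theta>
    using P by (simp add: kern_nonneg)
  show "(kern (norm P) has_integral 2 * pi) {0..2 * pi}"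
    using P by (simp add: kern_has_integral)
  have "continuous_on {0..2 * pi} ?c"
    by (rule continuous_on_compose2[OF continuous_on_circle_pt[of UNIV]])
      (use P in \<open>auto intro!: continuous_intros continuous_on_psi_star\<close>)
  then have "continuous_on {0..2 * pi} (\<lambda>\<theta>. \<phi> (?c \<theta>))"
    by (rule continuous_on_compose2[OF \<phi>(1)]) (use circle_pt_in_sphere in auto)
  moreover have "continuous_on {0..2 * pi} (kern (norm P))"
    using P by (simp add: continuous_on_kern)
  ultimately show "(\<lambda>\<theta>. kern (norm P) \<theta> *\<^sub>R \<phi> (?c \<theta>)) integrable_on {0..2 * pi}"
    by (intro integrable_continuous_real continuous_on_scaleR)
qed simp

theorem theorem11:
  fixes \<Omega> :: "(real ^ 2) set" and \<phi> :: "real ^ 2 \<Rightarrow> real ^ 2"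
  assumes "open \<Omega>" and "bounded \<Omega>" and "convex \<Omega>" and "\<Omega> \<noteq> {}"
    and "continuous_on (sphere 0 1) \<phi>"
    and "inj_on \<phi> (sphere 0 1)"
    and "\<phi> ` sphere 0 1 = frontier \<Omega>"
  shows "extension \<phi> ` ball 0 1 \<subseteq> closure \<Omega>"
proof -
  have "\<phi> ` sphere 0 1 \<subseteq> closure \<Omega>"
    using assms(7) by (simp add: frontier_def Diff_subset)
  then have "extension \<phi> P \<in> closure \<Omega>" if "norm P < 1" for P
    using that assms(3,5) by (intro extension_in_closed_convex convex_closure) auto
  then show ?thesis by auto
qed

end
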